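(* Let $l\ge4$ be an integer and let $x_1,x_2,x_3$ be indeterminates. Let $S_3$ be the set of all permutations of $\{1,2,3\}$ and $C=\{(1,2,3),(2,3,1),(3,1,2)\}$. Then \[ \begin{aligned} \sum_{\sigma\in S_3} T_l\big(x_1+x_2+x_3,\,x_{\sigma(2)}+x_{\sigma(3)},\,x_{\sigma(3)}\big) =\sum_{(i,j,k)\in C}\Big[&T_l(x_i+x_k,x_j+x_k,x_k)+T_l(x_i+x_k,x_k+x_j,x_j)+T_l(x_k+x_i,x_i,x_j)\\ &-T_l(x_i,x_j,x_k)+\frac{x_i^{l-1}}{(x_i-x_j)(x_i-x_k)}\,\zeta(l)\Big]. \end{aligned} \] Equivalently, \[ \sum_{\substack{l_1\ge2,\,l_2,l_3\ge1\\ l_1+l_2+l_3=l}} c_{l_1,l_2,l_3}(x_1,x_2,x_3)\,\zeta(l_1,l_2,l_3)=\Big(\sum_{\substack{l_1,l_2,l_3\ge1\\ l_1+l_2+l_3=l}}x_1^{l_1-1}x_2^{l_2-1}x_3^{l_3-1}\Big)\zeta(l), \] where \[ \begin{aligned} c_{l_1,l_2,l_3}=&\sum_{\sigma\in S_3}(x_1+x_2+x_3)^{l_1-1}(x_{\sigma(2)}+x_{\sigma(3)})^{l_2-1}x_{\sigma(3)}^{l_3-1}\\ &+\sum_{(i,j,k)\in C}\Big(x_i^{l_1-1}x_j^{l_2-1}x_k^{l_3-1}-(x_i+x_k)^{l_1-1}(x_j+x_k)^{l_2-1}x_k^{l_3-1}\\ &\qquad-(x_i+x_k)^{l_1-1}(x_k+x_j)^{l_2-1}x_j^{l_3-1}-(x_k+x_i)^{l_1-1}x_i^{l_2-1}x_j^{l_3-1}\Big).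 \end{aligned} \]
   Context: For positive integers $l_1\ge2,l_2,\dots,l_n$, $\zeta(l_1,\dots,l_n)=\sum_{m_1>\cdots>m_n>0}\frac{1}{m_1^{l_1}\cdots m_n^{l_n}}$. The generating function of triple zeta values of weight $l$ is $T_l(x_1,x_2,x_3)=\sum_{l_1\ge2,\,l_2,l_3\ge1,\,l_1+l_2+l_3=l} x_1^{l_1-1}x_2^{l_2-1}x_3^{l_3-1}\zeta(l_1,l_2,l_3)$. The first identity is an identity of rational functions in $x_1,x_2,x_3$. *)

theory Defs
  imports
    "HOL-Analysis.Analysis"
    "HOL-Computational_Algebra.Polynomial"
    "HOL-Computational_Algebra.Fraction_Field"
    "HOL-Combinatorics.Permutations"
begin

text \<open>
  Summation indices \<open>m\<^sub>1 > \<dots> > m\<^sub>n > 0\<close>, as lists of length \<open>n\<close>.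
\<close>

definition mzv_indices :: "nat \<Rightarrow> nat list set" where
  "mzv_indices n = {ms. length ms = n \<and> sorted_wrt (>) ms \<and> (\<forall>m \<in> set ms. m > 0)}"

text \<open>
  All terms are nonnegative, so the unordered sum is the usual value of the series.
  The definition is meaningful for positive exponents with \<open>ls ! 0 \<ge> 2\<close>, which ensures
  convergence (\<open>infsum\<close> of a non-summable family is \<open>0\<close>).
\<close>

definition mzv :: "nat list \<Rightarrow> real" where
  "mzv ls = (\<Sum>\<^sub>\<infinity>ms\<in>mzv_indices (length ls). \<Prod>i<length ls. 1 / real (ms ! i) ^ (ls ! i))"

text \<open>
  The field \<open>\<real>(x\<^sub>1, x\<^sub>2, x\<^sub>3)\<close>, as the fraction field of \<open>\<real>[x\<^sub>1][x\<^sub>2][x\<^sub>3]\<close>.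
\<close>

type_synonym ratfun3 = "real poly poly poly fract"

definition rf_const :: "real \<Rightarrow> ratfun3" where
  "rf_const r = Fract [:[:[:r:]:]:] 1"

text \<open>Only the indices 1, 2, 3 are meaningful.\<close>

definition X :: "nat \<Rightarrow> ratfun3" where
  "X i = (if i = 1 then Fract [:[:[:0, 1:]:]:] 1
          else if i = 2 then Fract [:[:0, 1:]:] 1
          else if i = 3 then Fract [:0, 1:] 1
          else 0)"

lemma X_distinct: "X 1 \<noteq> X 2" "X 1 \<noteq> X 3" "X 2 \<noteq> X 3"
  by (simp_all add: X_def eq_fract one_pCons)

definition triples :: "nat \<Rightarrow> (nat \<times> nat \<times> nat) set" where
  "triples l = {(l1, l2, l3). l1 \<ge> 1 \<and> l2 \<ge> 1 \<and> l3 \<ge> 1 \<and> l1 + l2 + l3 = l}"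

definition adm_triples :: "nat \<Rightarrow> (nat \<times> nat \<times> nat) set" where
  "adm_triples l = {(l1, l2, l3). l1 \<ge> 2 \<and> l2 \<ge> 1 \<and> l3 \<ge> 1 \<and> l1 + l2 + l3 = l}"

lemma finite_triples: "finite (triples l)" "finite (adm_triples l)"
proof -
  have "finite ({..l} \<times> {..l} \<times> {..l})" by simp
  moreover have "triples l \<subseteq> {..l} \<times> {..l} \<times> {..l}" "adm_triples l \<subseteq> {..l} \<times> {..l} \<times> {..l}"
    by (auto simp: triples_def adm_triples_def)
  ultimately show "finite (triples l)" "finite (adm_triples l)"
    using finite_subset by blast+
qed

definition T :: "nat \<Rightarrow> ratfun3 \<Rightarrow> ratfun3 \<Rightarrow> ratfun3 \<Rightarrow> ratfun3" where
  "T l y1 y2 y3 =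
     (\<Sum>(l1, l2, l3)\<in>adm_triples l.
        y1 ^ (l1 - 1) * y2 ^ (l2 - 1) * y3 ^ (l3 - 1) * rf_const (mzv [l1, l2, l3]))"

definition S3 :: "(nat \<Rightarrow> nat) set" where
  "S3 = {\<sigma>. \<sigma> permutes {1, 2, 3}}"

lemma finite_S3: "finite S3"
  unfolding S3_def by (rule finite_permutations) simp

definition C3 :: "(nat \<times> nat \<times> nat) set" where
  "C3 = {(1, 2, 3), (2, 3, 1), (3, 1, 2)}"

definition c_coeff :: "nat \<Rightarrow> nat \<Rightarrow> nat \<Rightarrow> ratfun3" where
  "c_coeff l1 l2 l3 =
     (\<Sum>\<sigma>\<in>S3. (X 1 + X 2 + X 3) ^ (l1 - 1) * (X (\<sigma> 2) + X (\<sigma> 3)) ^ (l2 - 1) * X (\<sigma> 3) ^ (l3 - 1))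
   + (\<Sum>(i, j, k)\<in>C3.
         X i ^ (l1 - 1) * X j ^ (l2 - 1) * X k ^ (l3 - 1)
       - (X i + X k) ^ (l1 - 1) * (X j + X k) ^ (l2 - 1) * X k ^ (l3 - 1)
       - (X i + X k) ^ (l1 - 1) * (X k + X j) ^ (l2 - 1) * X j ^ (l3 - 1)
       - (X k + X i) ^ (l1 - 1) * X i ^ (l2 - 1) * X j ^ (l3 - 1))"

end

theory Submission
  imports
    Defs
    "HOL-Computational_Algebra.Polynomial_Factorial"
    "HOL-Real_Asymp.Real_Asymp"
begin

text \<open>
  Fix real values \<open>x, y, z\<close> of the indeterminates. With \<open>F\<close> the full generating series
  \<open>\<Sum> 1 / ((m\<^sub>1 - y\<^sub>1) (m\<^sub>2 - y\<^sub>2) (m\<^sub>3 - y\<^sub>3))\<close>, repeated use of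
  \<open>1 / (A B) = (1 / A + 1 / B) / (A + B)\<close> turns the sum over \<open>S\<^sub>3\<close> into a product of three
  single series and each triple of series at \<open>(x\<^sub>i + x\<^sub>k, \<dots>)\<close> into the product of a double and a
  single series. After subtracting, every \<open>(a, b, c)\<close> that is not on the diagonal gets total
  multiplicity 0, and the diagonal yields \<open>\<zeta>(l)\<close>.

  These series diverge, so the largest index is cut off at \<open>N\<close>. The terms with \<open>l\<^sub>1 = 1\<close>
  cancel for each \<open>N\<close>, and the multiplicities are wrong only in a boundary layer, whose
  contribution is \<open>O((log N)\<^sup>2 / N)\<close> in weight \<open>l \<ge> 4\<close> (in weight 3 it does not vanish in the limit).
  An identity valid at all real points is an identity of polynomials.
\<close>

subsection \<open>Truncated shuffle relations\<close>

text \<open>The Cauchy product: the exponents \<open>l1 - 1\<close>, \<open>l2 - 1\<close>,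
  \<open>l3 - 1\<close> add up to \<open>l - 3\<close>. For \<open>l < 3\<close> the sum is empty,
  whereas truncated subtraction would select the constant coefficient.\<close>

lemma sum_triples_eq_fps_nth:
  fixes f g h :: "nat \<Rightarrow> 'a::comm_ring_1"
  assumes "l \<ge> 3"
  shows "(\<Sum>(l1, l2, l3)\<in>triples l. f (l1 - 1) * g (l2 - 1) * h (l3 - 1))
       = fps_nth (Abs_fps f * Abs_fps g * Abs_fps h) (l - 3)"
proof -
  have "fps_nth (Abs_fps f * (Abs_fps g * Abs_fps h)) (l - 3)
      = (\<Sum>(i, j)\<in>(SIGMA i:{0..l-3}. {0..l-3-i}). f i * g j * h (l - 3 - i - j))"
    by (simp add: fps_mult_nth sum_distrib_left sum.Sigma mult.assoc)
  also have "\<dots> = (\<Sum>(l1, l2, l3)\<in>triples l. f (l1 - 1) * g (l2 - 1) * h (l3 - 1))"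
    using assms
    by (intro sum.reindex_bij_witness[where j = "\<lambda>(i, j). (i + 1, j + 1, l - 2 - i - j)"
          and i = "\<lambda>(l1, l2, l3). (l1 - 1, l2 - 1)"]) (auto simp: triples_def algebra_simps numeral_3_eq_3)
  finally show ?thesis by (simp add: mult.assoc)
qed

text \<open>\<open>geo y m\<close> is \<open>1 / (m - y t)\<close> as a power series in \<open>t\<close>.\<close>

definition geo :: "real \<Rightarrow> real \<Rightarrow> real fps" where
  "geo y m = Abs_fps (\<lambda>n. y ^ n / m ^ (n + 1))"

lemma geo_mult:
  assumes "m \<noteq> 0"
  shows "geo y m * (fps_const m - fps_const y * fps_X) = 1"
proof (rule fps_ext)
  fix n
  show "fps_nth (geo y m * (fps_const m - fps_const y * fps_X)) n = fps_nth 1 n"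
    using assms
    by (cases n) (simp_all add: geo_def right_diff_distrib mult.commute[of "fps_const y"] flip: mult.assoc)
qed

text \<open>The denominators \<open>m - x t\<close> and \<open>n - y t\<close> add up to one of the
  same shape, so summation indices and arguments get added in parallel. Positivity keeps all three
  invertible.\<close>

lemma geo_shuffle:
  assumes "m > 0" "n > 0"
  shows "geo x m * geo y n = (geo x m + geo y n) * geo (x + y) (m + n)"
proof -
  define A B S where "A = fps_const m - fps_const x * fps_X"
    and "B = fps_const n - fps_const y * fps_X"
    and "S = fps_const (m + n) - fps_const (x + y) * fps_X"
  have S: "S = A + B"
    by (simp add: A_def B_def S_def algebra_simps flip: fps_const_add)
  have A: "geo x m * A = 1" and B: "geo y n * B = 1" and G: "geo (x + y) (m + n) * S = 1"
    unfolding A_def B_def S_def using assms by (auto intro!: geo_mult)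
  have "geo x m * geo y n = geo x m * geo y n * (geo (x + y) (m + n) * S)"
    by (simp add: G)
  also have "\<dots> = (geo x m * A * geo y n + geo y n * B * geo x m) * geo (x + y) (m + n)"
    by (simp add: S algebra_simps)
  finally show ?thesis unfolding A B by (simp add: add.commute)
qed

definition hom3 :: "nat \<Rightarrow> real \<Rightarrow> real \<Rightarrow> real \<Rightarrow> real \<Rightarrow> real \<Rightarrow> real \<Rightarrow> real" where
  "hom3 l y1 y2 y3 m1 m2 m3 = (\<Sum>(l1, l2, l3)\<in>triples l.
     y1 ^ (l1 - 1) * y2 ^ (l2 - 1) * y3 ^ (l3 - 1) * (1 / (m1 ^ l1 * m2 ^ l2 * m3 ^ l3)))"

lemma hom3_eq:
  assumes "l \<ge> 3"
  shows "hom3 l y1 y2 y3 m1 m2 m3 = fps_nth (geo y1 m1 * geo y2 m2 * geo y3 m3) (l - 3)"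
proof -
  have "hom3 l y1 y2 y3 m1 m2 m3 = (\<Sum>(l1, l2, l3)\<in>triples l.
     y1 ^ (l1 - 1) / m1 ^ (l1 - 1 + 1) * (y2 ^ (l2 - 1) / m2 ^ (l2 - 1 + 1)) *
     (y3 ^ (l3 - 1) / m3 ^ (l3 - 1 + 1)))"
    unfolding hom3_def by (intro sum.cong) (auto simp: triples_def Suc_le_eq gr0_conv_Suc)
  also have "\<dots> = fps_nth (geo y1 m1 * geo y2 m2 * geo y3 m3) (l - 3)"
    unfolding geo_def by (rule sum_triples_eq_fps_nth[OF assms])
  finally show ?thesis .
qed

lemma hom3_rotate: "l \<ge> 3 \<Longrightarrow> hom3 l y2 y3 y1 m2 m3 m1 = hom3 l y1 y2 y3 m1 m2 m3"
  by (simp add: hom3_eq mult_ac)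

text \<open>A double-series term at \<open>(a + b, b)\<close> times a single-series term at
  \<open>c\<close>. Merging \<open>c\<close> with the outer index first leaves either a finished
  term or the product of the terms at \<open>b\<close> and \<open>c\<close>, which is merged once
  more.\<close>

lemma hom3_shuffle21:
  assumes "l \<ge> 3" "a > 0" "b > 0" "c > 0"
  shows "hom3 l x y z (a + b) b c =
     hom3 l (x + z) (y + z) z (a + b + c) (b + c) c
   + hom3 l (x + z) (y + z) y (a + b + c) (b + c) b
   + hom3 l (x + z) x y (a + b + c) (a + b) b"
proof -
  have 1: "geo y b * geo z c = (geo y b + geo z c) * geo (y + z) (b + c)"
    using assms by (intro geo_shuffle) auto
  have 2: "geo x (a + b) * geo z c = (geo x (a + b) + geo z c) * geo (x + z) (a + b + c)"
    using assms by (intro geo_shuffle) auto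
  have "geo x (a + b) * geo y b * geo z c = geo y b * (geo x (a + b) * geo z c)"
    by (simp add: mult_ac)
  also have "\<dots> = geo (x + z) (a + b + c) * (geo x (a + b) * geo y b + geo y b * geo z c)"
    unfolding 2 by (simp add: algebra_simps)
  also have "\<dots> = geo (x + z) (a + b + c) * geo (y + z) (b + c) * geo z c
    + geo (x + z) (a + b + c) * geo (y + z) (b + c) * geo y b
    + geo (x + z) (a + b + c) * geo x (a + b) * geo y b"
    unfolding 1 by (simp add: algebra_simps)
  finally show ?thesis
    using assms by (simp add: hom3_eq)
qed

text \<open>The six summands are the orders in which \<open>a\<close>, \<open>b\<close>,
  \<open>c\<close> can be accumulated: a single index, then a sum of two, then the total.\<close>

lemma hom3_shuffle111:
  assumes "l \<ge> 3" "a > 0" "b > 0" "c > 0"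
  shows "hom3 l x y z a b c =
     hom3 l (x + y + z) (y + z) z (a + b + c) (b + c) c
   + hom3 l (x + y + z) (y + z) y (a + b + c) (b + c) b
   + hom3 l (x + y + z) (x + z) z (a + b + c) (a + c) c
   + hom3 l (x + y + z) (x + z) x (a + b + c) (a + c) a
   + hom3 l (x + y + z) (x + y) y (a + b + c) (a + b) b
   + hom3 l (x + y + z) (x + y) x (a + b + c) (a + b) a"
proof -
  have 1: "geo y b * geo z c = (geo y b + geo z c) * geo (y + z) (b + c)"
   and 2: "geo x a * geo z c = (geo x a + geo z c) * geo (x + z) (a + c)"
   and 3: "geo x a * geo y b = (geo x a + geo y b) * geo (x + y) (a + b)"
   and 4: "geo (x + y) (a + b) * geo z c
         = (geo (x + y) (a + b) + geo z c) * geo (x + y + z) (a + b + c)"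
    using assms by (auto intro!: geo_shuffle)
  have "geo x a * geo y b * geo z c = (geo x a + geo y b) * (geo (x + y) (a + b) * geo z c)"
    unfolding 3 by (simp add: mult_ac)
  also have "\<dots> = geo (x + y + z) (a + b + c) * ((geo x a + geo y b) * geo (x + y) (a + b)
      + geo x a * geo z c + geo y b * geo z c)"
    unfolding 4 by (simp add: algebra_simps)
  also have "\<dots> = geo (x + y + z) (a + b + c) * ((geo x a + geo y b) * geo (x + y) (a + b)
      + (geo x a + geo z c) * geo (x + z) (a + c) + (geo y b + geo z c) * geo (y + z) (b + c))"
    unfolding 1 2 ..
  also have "\<dots> = geo (x + y + z) (a + b + c) * geo (y + z) (b + c) * geo z c
    + geo (x + y + z) (a + b + c) * geo (y + z) (b + c) * geo y b
    + geo (x + y + z) (a + b + c) * geo (x + z) (a + c) * geo z c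
    + geo (x + y + z) (a + b + c) * geo (x + z) (a + c) * geo x a
    + geo (x + y + z) (a + b + c) * geo (x + y) (a + b) * geo y b
    + geo (x + y + z) (a + b + c) * geo (x + y) (a + b) * geo x a"
    by (simp only: ring_distribs mult_ac add_ac)
  finally show ?thesis
    using assms(1) by (simp only: hom3_eq fps_add_nth)
qed

section \<open>Lattice sums over a tetrahedron and a cube\<close>

text \<open>In the coordinates \<open>m1 = a + b + c\<close>, \<open>m2 = b + c\<close>,
  \<open>m3 = c\<close> this is the cut-off \<open>m1 \<le> N\<close>. The set is symmetric in
  \<open>a\<close>, \<open>b\<close>, \<open>c\<close>, so the variables can be renamed in each term
  of a shuffle separately.\<close>

definition tetra :: "nat \<Rightarrow> (nat \<times> nat \<times> nat) set" where
  "tetra N = {(a, b, c). a \<ge> 1 \<and> b \<ge> 1 \<and> c \<ge> 1 \<and> a + b + c \<le> N}"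

definition cube :: "nat \<Rightarrow> (nat \<times> nat \<times> nat) set" where
  "cube N = {1..N} \<times> {1..N} \<times> {1..N}"

lemma finite_cube [simp]: "finite (cube N)"
  by (simp add: cube_def)

lemma tetra_subset_cube: "tetra N \<subseteq> cube N"
  by (auto simp: tetra_def cube_def)

lemma finite_tetra [simp]: "finite (tetra N)"
  using tetra_subset_cube finite_cube by (rule finite_subset)

lemma sum_tetra_permute:
  shows "(\<Sum>(a, b, c)\<in>tetra N. f b c a) = (\<Sum>(a, b, c)\<in>tetra N. f a b c)"
  and "(\<Sum>(a, b, c)\<in>tetra N. f c a b) = (\<Sum>(a, b, c)\<in>tetra N. f a b c)"
  and "(\<Sum>(a, b, c)\<in>tetra N. f b a c) = (\<Sum>(a, b, c)\<in>tetra N. f a b c)"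
  and "(\<Sum>(a, b, c)\<in>tetra N. f a c b) = (\<Sum>(a, b, c)\<in>tetra N. f a b c)"
  and "(\<Sum>(a, b, c)\<in>tetra N. f c b a) = (\<Sum>(a, b, c)\<in>tetra N. f a b c)"
proof -
  show "(\<Sum>(a, b, c)\<in>tetra N. f b c a) = (\<Sum>(a, b, c)\<in>tetra N. f a b c)"
    by (rule sum.reindex_bij_witness[where i = "\<lambda>(a, b, c). (c, a, b)" and j = "\<lambda>(a, b, c). (b, c, a)"])
      (auto simp: tetra_def)
  show "(\<Sum>(a, b, c)\<in>tetra N. f c a b) = (\<Sum>(a, b, c)\<in>tetra N. f a b c)"
    by (rule sum.reindex_bij_witness[where i = "\<lambda>(a, b, c). (b, c, a)" and j = "\<lambda>(a, b, c). (c, a, b)"])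
      (auto simp: tetra_def)
  show "(\<Sum>(a, b, c)\<in>tetra N. f b a c) = (\<Sum>(a, b, c)\<in>tetra N. f a b c)"
    by (rule sum.reindex_bij_witness[where i = "\<lambda>(a, b, c). (b, a, c)" and j = "\<lambda>(a, b, c). (b, a, c)"])
      (auto simp: tetra_def)
  show "(\<Sum>(a, b, c)\<in>tetra N. f a c b) = (\<Sum>(a, b, c)\<in>tetra N. f a b c)"
    by (rule sum.reindex_bij_witness[where i = "\<lambda>(a, b, c). (a, c, b)" and j = "\<lambda>(a, b, c). (a, c, b)"])
      (auto simp: tetra_def)
  show "(\<Sum>(a, b, c)\<in>tetra N. f c b a) = (\<Sum>(a, b, c)\<in>tetra N. f a b c)"
    by (rule sum.reindex_bij_witness[where i = "\<lambda>(a, b, c). (c, b, a)" and j = "\<lambda>(a, b, c). (c, b, a)"])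
      (auto simp: tetra_def)
qed

lemma sum_cube_rotate:
  "(\<Sum>(a, b, c)\<in>cube N. f b c a) = (\<Sum>(a, b, c)\<in>cube N. f a b c)"
  by (rule sum.reindex_bij_witness[where i = "\<lambda>(a, b, c). (c, a, b)" and j = "\<lambda>(a, b, c). (b, c, a)"])
     (auto simp: cube_def)

lemma sum_tetra_eq_cube:
  fixes f :: "nat \<Rightarrow> nat \<Rightarrow> nat \<Rightarrow> real"
  shows "(\<Sum>(a, b, c)\<in>tetra N. f a b c) = (\<Sum>(a, b, c)\<in>cube N. of_bool (a + b + c \<le> N) * f a b c)"
  by (rule sum.mono_neutral_cong_left) (auto simp: cube_def tetra_def)

text \<open>The cut-off of the total turns into \<open>a + c \<le> N\<close> rather than into
  \<open>a \<le> N\<close>. Such mismatches between the regions create the boundary layer.\<close>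

lemma sum_tetra_shift1:
  fixes f :: "nat \<Rightarrow> nat \<Rightarrow> nat \<Rightarrow> real"
  shows "(\<Sum>(a, b, c)\<in>tetra N. f (a + b) b c)
       = (\<Sum>(a, b, c)\<in>cube N. of_bool (b < a \<and> a + c \<le> N) * f a b c)"
proof -
  have "(\<Sum>(a, b, c)\<in>tetra N. f (a + b) b c)
      = (\<Sum>(a, b, c)\<in>{(a, b, c) \<in> cube N. b < a \<and> a + c \<le> N}. f a b c)"
    by (rule sum.reindex_bij_witness[where i = "\<lambda>(a, b, c). (a - b, b, c)"
          and j = "\<lambda>(a, b, c). (a + b, b, c)"]) (auto simp: cube_def tetra_def)
  also have "\<dots> = (\<Sum>(a, b, c)\<in>cube N. of_bool (b < a \<and> a + c \<le> N) * f a b c)"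
    by (rule sum.mono_neutral_cong_left) auto
  finally show ?thesis .
qed

lemma sum_tetra_shift2:
  fixes f :: "nat \<Rightarrow> nat \<Rightarrow> nat \<Rightarrow> real"
  shows "(\<Sum>(a, b, c)\<in>tetra N. f (a + b + c) (b + c) c)
       = (\<Sum>(a, b, c)\<in>cube N. of_bool (c < b \<and> b < a) * f a b c)"
proof -
  have "(\<Sum>(a, b, c)\<in>tetra N. f (a + b + c) (b + c) c)
      = (\<Sum>(a, b, c)\<in>{(a, b, c) \<in> cube N. c < b \<and> b < a}. f a b c)"
    by (rule sum.reindex_bij_witness[where i = "\<lambda>(a, b, c). (a - b, b - c, c)"
          and j = "\<lambda>(a, b, c). (a + b + c, b + c, c)"]) (auto simp: cube_def tetra_def)
  also have "\<dots> = (\<Sum>(a, b, c)\<in>cube N. of_bool (c < b \<and> b < a) * f a b c)"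
    by (rule sum.mono_neutral_cong_left) auto
  finally show ?thesis .
qed

subsection \<open>The boundary layer\<close>

text \<open>
  The number of times the lattice point \<open>(a, b, c)\<close> is counted when all truncated generating
  functions are expanded; it tends to \<open>of_bool (a = b \<and> b = c)\<close> as \<open>N\<close> grows.
\<close>

definition shuffle_weight :: "nat \<Rightarrow> nat \<Rightarrow> nat \<Rightarrow> nat \<Rightarrow> real" where
  "shuffle_weight N a b c = of_bool (a + b + c \<le> N)
     - of_bool (b < a \<and> a + c \<le> N) - of_bool (c < b \<and> b + a \<le> N) - of_bool (a < c \<and> c + b \<le> N)
     + of_bool (c < b \<and> b < a) + of_bool (a < c \<and> c < b) + of_bool (b < a \<and> a < c)"

text \<open>
  For given \<open>p\<close> and \<open>q\<close> at most \<open>2 min p q\<close> values of the largest coordinate \<open>m\<close> are affected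
  by the truncation, and they all satisfy \<open>3 m \<ge> N\<close>.
\<close>

definition boundary :: "nat \<Rightarrow> nat \<Rightarrow> nat \<Rightarrow> nat \<Rightarrow> bool" where
  "boundary N m p q \<longleftrightarrow> p \<le> m \<and> q \<le> m \<and>
     (N < m + min p q \<or> (m + max p q \<le> N \<and> N < m + p + q))"

text \<open>Let P, Q, R be the indicators of \<open>b < a\<close>, \<open>c < b\<close>,
  \<open>a < c\<close>. Without the cut-offs the weight is 1 - P - Q - R + PQ + QR + RP. Since PQR =
  0, this equals (1 - P)(1 - Q)(1 - R), the indicator of \<open>a \<le> b\<close>,
  \<open>b \<le> c\<close> and \<open>c \<le> a\<close>, that is, of the diagonal. The case analysis
  verifies that the cut-offs change it only in the boundary layer.\<close>

lemma shuffle_weight_bound: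
  assumes "(a, b, c) \<in> cube N"
  shows "\<bar>shuffle_weight N a b c - of_bool (a = b \<and> b = c)\<bar>
       \<le> of_bool (boundary N a b c) + of_bool (boundary N b a c) + of_bool (boundary N c a b)"
proof -
  have *: "a \<ge> 1" "b \<ge> 1" "c \<ge> 1" "a \<le> N" "b \<le> N" "c \<le> N"
    using assms by (auto simp: cube_def)
  show ?thesis
    by (cases a b rule: linorder_cases; cases b c rule: linorder_cases; cases a c rule: linorder_cases;
        cases "a + b + c \<le> N"; cases "a + b \<le> N"; cases "a + c \<le> N"; cases "b + c \<le> N";
        use * in \<open>(linarith | simp add: shuffle_weight_def boundary_def min_def max_def
          add.commute add.left_commute)\<close>)
qed

lemma card_boundary:
  assumes "p \<in> {1..N}" "q \<in> {1..N}"
  shows "card {m \<in> {1..N}. boundary N m p q} \<le> 2 * min p q"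
proof -
  \<comment> \<open>One interval for each alternative in \<open>boundary\<close>; each has at most
    \<open>min p q\<close> elements, as \<open>p + q - max p q = min p q\<close>.\<close>
  have "{m \<in> {1..N}. boundary N m p q} \<subseteq> {N + 1 - min p q..N} \<union> {N + 1 - (p + q)..N - max p q}"
    by (auto simp: boundary_def)
  then have "card {m \<in> {1..N}. boundary N m p q}
      \<le> card ({N + 1 - min p q..N} \<union> {N + 1 - (p + q)..N - max p q})"
    by (rule card_mono[rotated]) simp
  also have "\<dots> \<le> card {N + 1 - min p q..N} + card {N + 1 - (p + q)..N - max p q}"
    by (rule card_Un_le)
  also have "\<dots> \<le> 2 * min p q"
    using assms by (auto simp: min_def max_def)
  finally show ?thesis .
qed

text \<open>The largest coordinate \<open>a\<close> is summed first. It takes at most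
  \<open>2 * min b c\<close> values, which cancels \<open>min b c\<close> in the denominator, and
  each of them has \<open>1 / a \<le> 3 / N\<close>. What remains is a product of two harmonic
  sums.\<close>

lemma boundary_sum_le:
  "(\<Sum>(a, b, c)\<in>cube N. of_bool (boundary N a b c) / (real a * b * c * real (min b c)))
     \<le> 6 * harm N ^ 2 / N"
proof -
  have inner: "(\<Sum>a\<in>{1..N}. of_bool (boundary N a b c) / (real a * b * c * real (min b c)))
      \<le> 6 / N * (1 / b * (1 / c))" if "b \<in> {1..N}" "c \<in> {1..N}" for b c
  proof -
    have "(\<Sum>a\<in>{1..N}. of_bool (boundary N a b c) / (real a * b * c * real (min b c)))
        = (\<Sum>a\<in>{a \<in> {1..N}. boundary N a b c}. 1 / (real a * b * c * real (min b c)))"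
      by (rule sum.mono_neutral_cong_right) auto
    also have "\<dots> \<le> (\<Sum>a\<in>{a \<in> {1..N}. boundary N a b c}. 3 / (real N * b * c * real (min b c)))"
    proof (rule sum_mono)
      fix a assume a: "a \<in> {a \<in> {1..N}. boundary N a b c}"
      then have "N \<le> 3 * a" by (auto simp: boundary_def min_def split: if_splits)
      then have "real N \<le> 3 * real a" by linarith
      moreover have "real N > 0" "real a > 0" "real b > 0" "real c > 0" "real (min b c) > 0"
        using a that by auto
      ultimately show "1 / (real a * b * c * real (min b c)) \<le> 3 / (real N * b * c * real (min b c))"
        by (simp add: divide_simps)
    qed
    also have "\<dots> = real (card {a \<in> {1..N}. boundary N a b c}) * (3 / (real N * b * c * real (min b c)))"
      by simp
    also have "\<dots> \<le> real (2 * min b c) * (3 / (real N * b * c * real (min b c)))"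
      by (intro mult_right_mono of_nat_mono card_boundary that) auto
    also have "\<dots> = 6 / N * (1 / b * (1 / c))"
      using that by (simp add: field_simps)
    finally show ?thesis .
  qed
  have "(\<Sum>(a, b, c)\<in>cube N. of_bool (boundary N a b c) / (real a * b * c * real (min b c)))
      = (\<Sum>(b, c)\<in>{1..N} \<times> {1..N}. \<Sum>a\<in>{1..N}.
           of_bool (boundary N a b c) / (real a * b * c * real (min b c)))"
    unfolding case_prod_unfold by (subst sum.swap) (simp add: cube_def sum.cartesian_product case_prod_unfold)
  also have "\<dots> \<le> (\<Sum>(b, c)\<in>{1..N} \<times> {1..N}. 6 / N * (1 / b * (1 / c)))"
    using inner by (intro sum_mono) (auto simp del: of_nat_min)
  also have "\<dots> = 6 / N * (harm N * harm N)"
    unfolding harm_def sum_product unfolding sum.cartesian_product sum_distrib_left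
    by (simp only: case_prod_unfold inverse_eq_divide)
  finally show ?thesis by (simp add: power2_eq_square)
qed

lemma harm_square_over_tendsto_0: "(\<lambda>N. harm N ^ 2 / real N) \<longlonglongrightarrow> 0"
proof -
  \<comment> \<open>The difference of the harmonic number and the logarithm converges to the Euler
    constant, so \<open>harm N / sqrt N\<close> tends to 0; this is then squared.\<close>
  have "(\<lambda>N. (harm N - ln (real N)) * inverse (sqrt (real N)) + ln (real N) / sqrt (real N)) \<longlonglongrightarrow>
      euler_mascheroni * 0 + 0"
    by (intro tendsto_intros euler_mascheroni_LIMSEQ; real_asymp)
  then have "(\<lambda>N. ((harm N - ln (real N)) * inverse (sqrt (real N)) + ln (real N) / sqrt (real N))\<^sup>2) \<longlonglongrightarrow> 0"
    by (auto intro: tendsto_eq_intros)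
  also have "(\<lambda>N. ((harm N - ln (real N)) * inverse (sqrt (real N)) + ln (real N) / sqrt (real N))\<^sup>2)
      = (\<lambda>N. harm N ^ 2 / real N)"
    by (auto simp: fun_eq_iff divide_inverse power_mult_distrib power_inverse simp flip: ring_distribs)
  finally show ?thesis .
qed

text \<open>The exponents add up to \<open>l \<ge> 4\<close>, so beyond one factor each of
  \<open>a\<close>, \<open>b\<close>, \<open>c\<close> there is at least one more, and it is at
  least the minimum. This extra factor pays for the number of boundary points.\<close>

lemma abs_hom3_le:
  assumes "l \<ge> 4"
  obtains K where "K \<ge> 0" and "\<And>a b c :: nat. a \<ge> 1 \<Longrightarrow> b \<ge> 1 \<Longrightarrow> c \<ge> 1 \<Longrightarrow>
     \<bar>hom3 l x y z a b c\<bar> \<le> K / (real a * b * c * real (min a (min b c)))"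
proof
  define K where "K = (\<Sum>(l1, l2, l3)\<in>triples l. \<bar>x ^ (l1 - 1) * y ^ (l2 - 1) * z ^ (l3 - 1)\<bar>)"
  show "K \<ge> 0"
    unfolding K_def by (intro sum_nonneg) auto
  fix a b c :: nat
  assume abc: "a \<ge> 1" "b \<ge> 1" "c \<ge> 1"
  define m where "m = min a (min b c)"
  have m: "m \<ge> 1" "m \<le> a" "m \<le> b" "m \<le> c"
    using abc by (auto simp: m_def)
  have *: "a * b * c * m \<le> a ^ l1 * b ^ l2 * c ^ l3" if t: "(l1, l2, l3) \<in> triples l" for l1 l2 l3
  proof -
    obtain k1 k2 k3 where k: "l1 = Suc k1" "l2 = Suc k2" "l3 = Suc k3"
      using t by (auto simp: triples_def Suc_le_eq gr0_conv_Suc)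
    have "m \<le> m ^ (k1 + k2 + k3)"
      using m t assms by (intro self_le_power) (auto simp: triples_def k)
    also have "\<dots> \<le> a ^ k1 * b ^ k2 * c ^ k3"
      unfolding power_add using m by (intro mult_mono power_mono) auto
    finally have "a * b * c * m \<le> a * b * c * (a ^ k1 * b ^ k2 * c ^ k3)"
      by simp
    then show ?thesis by (simp add: k mult_ac)
  qed
  have "\<bar>hom3 l x y z a b c\<bar> \<le> (\<Sum>(l1, l2, l3)\<in>triples l.
      \<bar>x ^ (l1 - 1) * y ^ (l2 - 1) * z ^ (l3 - 1)\<bar> * (1 / (real a ^ l1 * b ^ l2 * c ^ l3)))"
    unfolding hom3_def by (rule order_trans[OF sum_abs]) (simp add: case_prod_unfold abs_mult)
  also have "\<dots> \<le> (\<Sum>(l1, l2, l3)\<in>triples l.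
      \<bar>x ^ (l1 - 1) * y ^ (l2 - 1) * z ^ (l3 - 1)\<bar> * (1 / (real a * b * c * m)))"
  proof (rule sum_mono, clarify)
    fix l1 l2 l3 assume "(l1, l2, l3) \<in> triples l"
    then have "real (a * b * c * m) \<le> real (a ^ l1 * b ^ l2 * c ^ l3)"
      using * by (intro of_nat_mono) auto
    then have "1 / (real a ^ l1 * b ^ l2 * c ^ l3) \<le> 1 / (real a * b * c * m)"
      using abc m by (intro divide_left_mono) auto
    then show "\<bar>x ^ (l1 - 1) * y ^ (l2 - 1) * z ^ (l3 - 1)\<bar> * (1 / (real a ^ l1 * b ^ l2 * c ^ l3))
      \<le> \<bar>x ^ (l1 - 1) * y ^ (l2 - 1) * z ^ (l3 - 1)\<bar> * (1 / (real a * b * c * m))"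
      by (rule mult_left_mono) simp
  qed
  also have "\<dots> = K / (real a * b * c * m)"
    by (simp add: K_def sum_divide_distrib case_prod_unfold)
  finally show "\<bar>hom3 l x y z a b c\<bar> \<le> K / (real a * b * c * real (min a (min b c)))"
    unfolding m_def .
qed

lemma weighted_hom3_tendsto:
  assumes "l \<ge> 4"
  shows "(\<lambda>N. (\<Sum>(a, b, c)\<in>cube N. shuffle_weight N a b c * hom3 l x y z a b c)
            - (\<Sum>m = 1..N. hom3 l x y z (real m) (real m) (real m))) \<longlonglongrightarrow> 0"
proof -
  obtain K where K: "K \<ge> 0" "\<And>a b c :: nat. a \<ge> 1 \<Longrightarrow> b \<ge> 1 \<Longrightarrow> c \<ge> 1 \<Longrightarrow>
     \<bar>hom3 l x y z a b c\<bar> \<le> K / (real a * b * c * real (min a (min b c)))"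
    using abs_hom3_le[OF assms] by metis
  define g where "g a b c = 1 / (real a * b * c * real (min a (min b c)))" for a b c :: nat
  have diag: "(\<Sum>m = 1..N. hom3 l x y z (real m) (real m) (real m))
      = (\<Sum>(a, b, c)\<in>cube N. of_bool (a = b \<and> b = c) * hom3 l x y z a b c)" for N
  proof -
    have "(\<Sum>(a, b, c)\<in>cube N. of_bool (a = b \<and> b = c) * hom3 l x y z a b c)
        = (\<Sum>(a, b, c)\<in>(\<lambda>m. (m, m, m)) ` {1..N}. hom3 l x y z a b c)"
      by (rule sum.mono_neutral_cong_right) (auto simp: cube_def)
    then show ?thesis by (subst (asm) sum.reindex) (auto simp: inj_on_def)
  qed
  have bd: "\<bar>(\<Sum>(a, b, c)\<in>cube N. shuffle_weight N a b c * hom3 l x y z a b c)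
      - (\<Sum>m = 1..N. hom3 l x y z (real m) (real m) (real m))\<bar> \<le> K * (18 * (harm N ^ 2 / N))" for N
  proof -
    define B where "B = (\<Sum>(a, b, c)\<in>cube N. of_bool (boundary N a b c) * g a b c)"
    \<comment> \<open>On this part of the boundary layer \<open>a\<close> is the largest coordinate,
      so \<open>min a (min b c)\<close> is \<open>min b c\<close>.\<close>
    have "B = (\<Sum>(a, b, c)\<in>cube N. of_bool (boundary N a b c) / (real a * b * c * real (min b c)))"
      unfolding B_def g_def by (rule sum.cong) (auto simp: boundary_def min_def)
    then have B: "B \<le> 6 * harm N ^ 2 / N"
      using boundary_sum_le by simp
    have B2: "(\<Sum>(a, b, c)\<in>cube N. of_bool (boundary N b a c) * g a b c) = B"
      unfolding B_def
      by (rule sum.reindex_bij_witness[where i = "\<lambda>(a, b, c). (b, a, c)" and j = "\<lambda>(a, b, c). (b, a, c)"])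
         (auto simp: cube_def g_def min.left_commute mult_ac)
    have B3: "(\<Sum>(a, b, c)\<in>cube N. of_bool (boundary N c a b) * g a b c) = B"
      unfolding B_def
      by (rule sum.reindex_bij_witness[where i = "\<lambda>(c, a, b). (a, b, c)" and j = "\<lambda>(a, b, c). (c, a, b)"])
         (auto simp: cube_def g_def min.left_commute min.commute mult_ac)
    have "K * (B + B + B) = K * (\<Sum>(a, b, c)\<in>cube N.
        (of_bool (boundary N a b c) + of_bool (boundary N b a c) + of_bool (boundary N c a b)) * g a b c)"
      using B2 B3 unfolding B_def by (simp only: case_prod_unfold ring_distribs sum.distrib)
    then have B': "(\<Sum>(a, b, c)\<in>cube N.
        (of_bool (boundary N a b c) + of_bool (boundary N b a c) + of_bool (boundary N c a b)) * (K * g a b c))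
        = K * (B + B + B)"
      by (simp add: sum_distrib_left case_prod_unfold mult.left_commute)
    have "\<bar>(\<Sum>(a, b, c)\<in>cube N. shuffle_weight N a b c * hom3 l x y z a b c)
        - (\<Sum>m = 1..N. hom3 l x y z (real m) (real m) (real m))\<bar>
        = \<bar>\<Sum>(a, b, c)\<in>cube N. (shuffle_weight N a b c - of_bool (a = b \<and> b = c)) * hom3 l x y z a b c\<bar>"
      unfolding diag sum_subtractf[symmetric] by (simp add: case_prod_unfold left_diff_distrib)
    also have "\<dots> \<le> (\<Sum>(a, b, c)\<in>cube N.
        \<bar>(shuffle_weight N a b c - of_bool (a = b \<and> b = c)) * hom3 l x y z a b c\<bar>)"
      by (rule order_trans[OF sum_abs]) (simp add: case_prod_unfold)
    also have "\<dots> \<le> (\<Sum>(a, b, c)\<in>cube N.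
        (of_bool (boundary N a b c) + of_bool (boundary N b a c) + of_bool (boundary N c a b)) * (K * g a b c))"
    proof (rule sum_mono, clarify)
      fix a b c assume abc: "(a, b, c) \<in> cube N"
      then have "\<bar>hom3 l x y z a b c\<bar> \<le> K * g a b c"
        using K(2)[of a b c] by (auto simp: cube_def g_def)
      then show "\<bar>(shuffle_weight N a b c - of_bool (a = b \<and> b = c)) * hom3 l x y z a b c\<bar> \<le>
          (of_bool (boundary N a b c) + of_bool (boundary N b a c) + of_bool (boundary N c a b)) * (K * g a b c)"
        unfolding abs_mult by (intro mult_mono shuffle_weight_bound[OF abc]) auto
    qed
    also have "\<dots> = K * (B + B + B)"
      by (rule B')
    \<comment> \<open>Three choices of the largest coordinate, each contributing at most 6 times
      \<open>harm N ^ 2 / N\<close>.\<close>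
    also have "\<dots> \<le> K * (18 * (harm N ^ 2 / N))"
      using B K(1) by (intro mult_left_mono) auto
    finally show ?thesis .
  qed
  have "(\<lambda>N. K * (18 * (harm N ^ 2 / real N))) \<longlonglongrightarrow> K * (18 * 0)"
    by (intro tendsto_intros harm_square_over_tendsto_0)
  then have lim: "(\<lambda>N. K * (18 * (harm N ^ 2 / real N))) \<longlonglongrightarrow> 0"
    by simp
  show ?thesis
    by (rule Lim_null_comparison[OF _ lim], rule always_eventually, unfold real_norm_def, rule allI, rule bd)
qed

subsection \<open>Convergence to multiple zeta values\<close>

text \<open>The sets \<open>F N\<close> need not be nested: every finite subset of \<open>A\<close>
  eventually lies in \<open>F N\<close>, so \<open>F\<close> tends to the filter along which
  \<open>infsum\<close> is the limit.\<close>

lemma sum_exhaustion_tendsto_infsum: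
  fixes f :: "'a \<Rightarrow> real"
  assumes "f summable_on A" and "\<And>N. finite (F N)" and "\<And>N. F N \<subseteq> A"
    and "\<And>x. x \<in> A \<Longrightarrow> eventually (\<lambda>N. x \<in> F N) sequentially"
  shows "(\<lambda>N. sum f (F N)) \<longlonglongrightarrow> infsum f A"
proof -
  have "filterlim F (finite_subsets_at_top A) sequentially"
    unfolding filterlim_finite_subsets_at_top
  proof (intro allI impI)
    fix X assume X: "finite X \<and> X \<subseteq> A"
    then have "eventually (\<lambda>N. \<forall>x\<in>X. x \<in> F N) sequentially"
      using assms(4) by (intro eventually_ball_finite) auto
    then show "eventually (\<lambda>N. finite (F N) \<and> X \<subseteq> F N \<and> F N \<subseteq> A) sequentially"
      by eventually_elim (use assms in auto)
  qed
  moreover have "(sum f \<longlongrightarrow> infsum f A) (finite_subsets_at_top A)"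
    using has_sum_infsum[OF assms(1)] by (simp add: has_sum_def)
  ultimately show ?thesis by (rule filterlim_compose[rotated])
qed

lemma zeta_tendsto_mzv:
  assumes "l \<ge> 2"
  shows "(\<lambda>N. \<Sum>m = 1..N. 1 / real m ^ l) \<longlonglongrightarrow> mzv [l]"
proof -
  have bij: "bij_betw (\<lambda>m. [m]) {1..} (mzv_indices 1)"
    by (rule bij_betwI[where g = hd]) (auto simp: mzv_indices_def length_Suc_conv Suc_le_eq)
  have "mzv [l] = (\<Sum>\<^sub>\<infinity>ms\<in>mzv_indices 1. 1 / real (ms ! 0) ^ l)"
    by (simp add: mzv_def)
  also have "\<dots> = (\<Sum>\<^sub>\<infinity>m\<in>{1..}. 1 / real ([m] ! 0) ^ l)"
    by (rule infsum_reindex_bij_betw[OF bij, symmetric])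
  finally have mzv: "mzv [l] = (\<Sum>\<^sub>\<infinity>m\<in>{1..}. 1 / real m ^ l)"
    by simp
  have "summable (\<lambda>m. 1 / real m ^ l)"
    using assms inverse_power_summable[of l] by (simp add: inverse_eq_divide)
  then have "(\<lambda>m. 1 / real m ^ l) summable_on UNIV"
    by (subst summable_on_UNIV_nonneg_real_iff) auto
  then have "(\<lambda>m. 1 / real m ^ l) summable_on {1..}"
    by (rule summable_on_subset_banach) simp
  then show ?thesis
    unfolding mzv
    by (rule sum_exhaustion_tendsto_infsum) (auto simp: eventually_at_top_linorder)
qed

definition trunc_mzv3 :: "nat \<Rightarrow> nat \<Rightarrow> nat \<Rightarrow> nat \<Rightarrow> real" where
  "trunc_mzv3 N l1 l2 l3 = (\<Sum>(a, b, c)\<in>tetra N.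
     1 / (real (a + b + c) ^ l1 * real (b + c) ^ l2 * real c ^ l3))"

text \<open>The least weight 4 is spread evenly over the three gaps: 4/3 exceeds 1, so the bound is
  a product of convergent series. A third of a power is moved from each of the two smaller indices
  to the largest one, and 4/3 + 1/3 + 1/3 = 2 is its least admissible exponent.\<close>

lemma mzv3_term_le:
  assumes "l1 \<ge> 2" "l2 \<ge> 1" "l3 \<ge> 1" "a \<ge> 1" "b \<ge> 1" "c \<ge> 1"
  shows "1 / (real (a + b + c) ^ l1 * real (b + c) ^ l2 * real c ^ l3)
       \<le> real a powr (-4/3) * real b powr (-4/3) * real c powr (-4/3)"
proof -
  define A B C where "A = real (a + b + c)" and "B = real (b + c)" and "C = real c"
  have pos: "1 \<le> C" "C \<le> B" "B \<le> A" "real a \<le> A" "real b \<le> B"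
    using assms by (auto simp: A_def B_def C_def)
  have "real a powr (4/3) * real b powr (4/3) * real c powr (4/3)
      \<le> A powr (4/3) * B powr (4/3) * C powr (4/3)"
    using pos by (intro mult_mono powr_mono2) (auto simp: C_def)
  also have "\<dots> = A powr (4/3) * (B powr (1/3) * B) * (C powr (1/3) * C)"
    using pos powr_add[of B "1/3" 1] powr_add[of C "1/3" 1] by simp
  also have "\<dots> \<le> A powr (4/3) * (A powr (1/3) * B) * (A powr (1/3) * C)"
    using pos by (intro mult_mono powr_mono2) auto
  also have "\<dots> = A ^ 2 * B ^ 1 * C ^ 1"
  proof -
    have "A powr (4/3) * A powr (1/3) * A powr (1/3) = A powr 2"
      by (simp flip: powr_add)
    also have "\<dots> = A ^ 2" using pos by (simp add: powr_numeral)
    finally show ?thesis by (simp add: mult_ac)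
  qed
  also have "\<dots> \<le> A ^ l1 * B ^ l2 * C ^ l3"
    using pos assms by (intro mult_mono power_increasing) auto
  finally have "real a powr (4/3) * real b powr (4/3) * real c powr (4/3) \<le> A ^ l1 * B ^ l2 * C ^ l3" .
  then have "1 / (A ^ l1 * B ^ l2 * C ^ l3) \<le> 1 / (real a powr (4/3) * real b powr (4/3) * real c powr (4/3))"
    using pos assms by (intro divide_left_mono) auto
  also have "\<dots> = real a powr (-4/3) * real b powr (-4/3) * real c powr (-4/3)"
    using powr_minus_divide[of _ "4/3 :: real"] by simp
  finally show ?thesis unfolding A_def B_def C_def .
qed

lemma trunc_mzv3_tendsto:
  assumes "l1 \<ge> 2" "l2 \<ge> 1" "l3 \<ge> 1"
  shows "(\<lambda>N. trunc_mzv3 N l1 l2 l3) \<longlonglongrightarrow> mzv [l1, l2, l3]"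
proof -
  define P where "P = {1::nat..} \<times> {1::nat..} \<times> {1::nat..}"
  define f where "f = (\<lambda>(a, b, c). 1 / (real (a + b + c) ^ l1 * real (b + c) ^ l2 * real c ^ l3))"
  define g where "g = (\<lambda>(a, b, c). [a + b + c, b + c, c :: nat])"
  have bij: "bij_betw g P (mzv_indices 3)"
    unfolding P_def g_def
    by (rule bij_betwI[where g = "\<lambda>ms. (ms ! 0 - ms ! 1, ms ! 1 - ms ! 2, ms ! 2)"])
       (auto simp: mzv_indices_def length_Suc_conv Suc_le_eq numeral_3_eq_3)
  have "mzv [l1, l2, l3] = (\<Sum>\<^sub>\<infinity>ms\<in>mzv_indices 3.
      1 / real (ms ! 0) ^ l1 * (1 / real (ms ! 1) ^ l2) * (1 / real (ms ! 2) ^ l3))"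
    by (simp add: mzv_def lessThan_Suc numeral_3_eq_3 numeral_2_eq_2 mult_ac)
  also have "\<dots> = (\<Sum>\<^sub>\<infinity>p\<in>P.
      1 / real (g p ! 0) ^ l1 * (1 / real (g p ! 1) ^ l2) * (1 / real (g p ! 2) ^ l3))"
    by (rule infsum_reindex_bij_betw[OF bij, symmetric])
  also have "\<dots> = infsum f P"
    by (rule infsum_cong) (auto simp: f_def g_def)
  finally have mzv: "mzv [l1, l2, l3] = infsum f P" .
  define s where "s = (\<lambda>m. real m powr (-4/3))"
  have "summable s"
    unfolding s_def by (subst summable_real_powr_iff) simp
  then have s: "sum s F \<le> suminf s" if "finite F" for F
    using that by (intro sum_le_suminf) (auto simp: s_def)
  have "f summable_on P"
  proof (rule nonneg_bdd_above_summable_on)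
    show "f x \<ge> 0" for x by (auto simp: f_def case_prod_unfold)
    show "bdd_above (sum f ` {F. F \<subseteq> P \<and> finite F})"
    proof (rule bdd_aboveI2)
      fix F assume F: "F \<in> {F. F \<subseteq> P \<and> finite F}"
      \<comment> \<open>The smallest box containing \<open>F\<close>; over a box the bound factors
        into three single sums.\<close>
      define G where "G = fst ` F \<times> fst ` snd ` F \<times> snd ` snd ` F"
      have "sum f F \<le> (\<Sum>(a, b, c)\<in>F. s a * s b * s c)"
      proof (rule sum_mono, clarify)
        fix a b c assume "(a, b, c) \<in> F"
        then have "a \<ge> 1" "b \<ge> 1" "c \<ge> 1" using F by (auto simp: P_def)
        from mzv3_term_le[OF assms this] show "f (a, b, c) \<le> s a * s b * s c"
          by (simp add: f_def s_def)
      qed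
      also have "\<dots> \<le> (\<Sum>(a, b, c)\<in>G. s a * s b * s c)"
        using F by (intro sum_mono2) (force simp: G_def s_def)+
      also have "\<dots> = sum s (fst ` F) * (sum s (fst ` snd ` F) * sum s (snd ` snd ` F))"
        unfolding G_def sum_product sum.cartesian_product
        by (simp add: case_prod_unfold mult.assoc)
      also have "\<dots> \<le> suminf s * (suminf s * suminf s)"
        using F by (intro mult_mono s mult_nonneg_nonneg sum_nonneg suminf_nonneg[OF \<open>summable s\<close>])
                   (auto simp: s_def)
      finally show "sum f F \<le> suminf s * (suminf s * suminf s)" .
    qed
  qed
  then have "(\<lambda>N. sum f (tetra N)) \<longlonglongrightarrow> infsum f P"
  proof (rule sum_exhaustion_tendsto_infsum)
    fix x assume x: "x \<in> P"
    obtain a b c where abc: "x = (a, b, c)" by (cases x)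
    show "eventually (\<lambda>N. x \<in> tetra N) sequentially"
      using eventually_ge_at_top[of "a + b + c"]
      by eventually_elim (use x in \<open>auto simp: abc P_def tetra_def\<close>)
  qed (simp, auto simp: P_def tetra_def)
  then show ?thesis
    unfolding mzv by (simp add: f_def trunc_mzv3_def)
qed

subsection \<open>The identity at real points\<close>

text \<open>This includes the terms with \<open>l1 = 1\<close>, which grow without bound with
  \<open>N\<close>; \<open>gen_coeff_1\<close> disposes of them before the limit is taken.\<close>

definition trunc_gen3 :: "nat \<Rightarrow> nat \<Rightarrow> real \<Rightarrow> real \<Rightarrow> real \<Rightarrow> real" where
  "trunc_gen3 N l y1 y2 y3 = (\<Sum>(a, b, c)\<in>tetra N. hom3 l y1 y2 y3 (a + b + c) (b + c) c)"

lemma trunc_gen3_eq: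
  "trunc_gen3 N l y1 y2 y3 = (\<Sum>(l1, l2, l3)\<in>triples l.
     y1 ^ (l1 - 1) * y2 ^ (l2 - 1) * y3 ^ (l3 - 1) * trunc_mzv3 N l1 l2 l3)"
  unfolding trunc_gen3_def hom3_def trunc_mzv3_def
  by (subst sum_distrib_left, simp only: case_prod_unfold, subst sum.swap) simp

text \<open>Sums \<open>hom3_shuffle111\<close> over \<open>tetra N\<close>. Each of the six terms
  has its own order of \<open>a\<close>, \<open>b\<close>, \<open>c\<close>, which the symmetry of
  \<open>tetra\<close> undoes.\<close>

lemma trunc_gen3_shuffle111:
  assumes "l \<ge> 3"
  shows "(\<Sum>(a, b, c)\<in>tetra N. hom3 l x y z a b c) =
     trunc_gen3 N l (x + y + z) (y + z) z + trunc_gen3 N l (x + y + z) (y + z) y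
   + trunc_gen3 N l (x + y + z) (x + z) z + trunc_gen3 N l (x + y + z) (x + z) x
   + trunc_gen3 N l (x + y + z) (x + y) y + trunc_gen3 N l (x + y + z) (x + y) x"
proof -
  define h where "h u v a b c = hom3 l (x + y + z) u v (real (a + b + c)) (real (b + c)) (real c)"
    for u v and a b c :: nat
  have h_sum: "(\<Sum>(a, b, c)\<in>tetra N. h u v a b c) = trunc_gen3 N l (x + y + z) u v" for u v
    by (simp add: h_def trunc_gen3_def)
  have "(\<Sum>(a, b, c)\<in>tetra N. hom3 l x y z a b c) =
      (\<Sum>(a, b, c)\<in>tetra N. h (y + z) z a b c + h (y + z) y a c b + h (x + z) z b a c
        + h (x + z) x b c a + h (x + y) y c a b + h (x + y) x c b a)"
  proof (rule sum.cong, simp, clarify)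
    fix a b c assume "(a, b, c) \<in> tetra N"
    then show "hom3 l x y z a b c = h (y + z) z a b c + h (y + z) y a c b + h (x + z) z b a c
        + h (x + z) x b c a + h (x + y) y c a b + h (x + y) x c b a"
      unfolding h_def using hom3_shuffle111[OF assms, of a b c x y z]
      by (simp add: tetra_def add_ac)
  qed
  also have "\<dots> = (\<Sum>(a, b, c)\<in>tetra N. h (y + z) z a b c) + (\<Sum>(a, b, c)\<in>tetra N. h (y + z) y a c b)
      + (\<Sum>(a, b, c)\<in>tetra N. h (x + z) z b a c) + (\<Sum>(a, b, c)\<in>tetra N. h (x + z) x b c a)
      + (\<Sum>(a, b, c)\<in>tetra N. h (x + y) y c a b) + (\<Sum>(a, b, c)\<in>tetra N. h (x + y) x c b a)"
    by (simp add: sum.distrib case_prod_unfold)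
  finally show ?thesis
    unfolding sum_tetra_permute(1)[of "h (x + z) x"] sum_tetra_permute(2)[of "h (x + y) y"]
      sum_tetra_permute(3)[of "h (x + z) z"] sum_tetra_permute(4)[of "h (y + z) y"]
      sum_tetra_permute(5)[of "h (x + y) x"]
    by (simp only: h_sum)
qed

lemma trunc_gen3_shuffle21:
  assumes "l \<ge> 3"
  shows "(\<Sum>(a, b, c)\<in>cube N. of_bool (b < a \<and> a + c \<le> N) * hom3 l x y z a b c) =
     trunc_gen3 N l (x + z) (y + z) z + trunc_gen3 N l (x + z) (y + z) y + trunc_gen3 N l (x + z) x y"
proof -
  define h where "h u v a b c = hom3 l (x + z) u v (real (a + b + c)) (real (b + c)) (real c)"
    for u v and a b c :: nat
  have h_sum: "(\<Sum>(a, b, c)\<in>tetra N. h u v a b c) = trunc_gen3 N l (x + z) u v" for u v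
    by (simp add: h_def trunc_gen3_def)
  have "(\<Sum>(a, b, c)\<in>cube N. of_bool (b < a \<and> a + c \<le> N) * hom3 l x y z a b c)
      = (\<Sum>(a, b, c)\<in>tetra N. hom3 l x y z (a + b) b c)"
    using sum_tetra_shift1[of "\<lambda>a b c. hom3 l x y z a b c" N] by simp
  also have "\<dots> = (\<Sum>(a, b, c)\<in>tetra N. h (y + z) z a b c + h (y + z) y a c b + h x y c a b)"
  proof (rule sum.cong, simp, clarify)
    fix a b c assume "(a, b, c) \<in> tetra N"
    then show "hom3 l x y z (a + b) b c = h (y + z) z a b c + h (y + z) y a c b + h x y c a b"
      unfolding h_def using hom3_shuffle21[OF assms, of a b c x y z]
      by (simp add: tetra_def add_ac)
  qed
  also have "\<dots> = (\<Sum>(a, b, c)\<in>tetra N. h (y + z) z a b c) + (\<Sum>(a, b, c)\<in>tetra N. h (y + z) y a c b)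
      + (\<Sum>(a, b, c)\<in>tetra N. h x y c a b)"
    by (simp add: sum.distrib case_prod_unfold)
  finally show ?thesis
    unfolding sum_tetra_permute(2)[of "h x y"] sum_tetra_permute(4)[of "h (y + z) y"]
    by (simp only: h_sum)
qed

lemma trunc_gen3_eq_cube:
  "trunc_gen3 N l x y z = (\<Sum>(a, b, c)\<in>cube N. of_bool (c < b \<and> b < a) * hom3 l x y z a b c)"
  using sum_tetra_shift2[of "\<lambda>a b c. hom3 l x y z a b c" N] by (simp add: trunc_gen3_def)

text \<open>Rotating arguments and indices together leaves \<open>hom3\<close> unchanged. Hence the
  series with cyclically permuted arguments are sums of the same function \<open>w\<close> over
  rotated regions, and the indicators of all regions add up to
  \<open>shuffle_weight\<close>.\<close>

lemma weighted_hom3_eq: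
  assumes "l \<ge> 3"
  shows "(\<Sum>(a, b, c)\<in>cube N. shuffle_weight N a b c * hom3 l x y z a b c) =
     trunc_gen3 N l (x + y + z) (y + z) z + trunc_gen3 N l (x + y + z) (y + z) y
   + trunc_gen3 N l (x + y + z) (x + z) z + trunc_gen3 N l (x + y + z) (x + z) x
   + trunc_gen3 N l (x + y + z) (x + y) y + trunc_gen3 N l (x + y + z) (x + y) x
   - (trunc_gen3 N l (x + z) (y + z) z + trunc_gen3 N l (x + z) (y + z) y + trunc_gen3 N l (x + z) x y)
   - (trunc_gen3 N l (y + x) (z + x) x + trunc_gen3 N l (y + x) (z + x) z + trunc_gen3 N l (y + x) y z)
   - (trunc_gen3 N l (z + y) (x + y) y + trunc_gen3 N l (z + y) (x + y) x + trunc_gen3 N l (z + y) z x)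
   + trunc_gen3 N l x y z + trunc_gen3 N l y z x + trunc_gen3 N l z x y"
proof -
  define w where "w a b c = hom3 l x y z (real a) (real b) (real c)" for a b c :: nat
  have yzx: "hom3 l y z x (real a) (real b) (real c) = w c a b"
    and zxy: "hom3 l z x y (real a) (real b) (real c) = w b c a" for a b c :: nat
    unfolding w_def using hom3_rotate[OF assms] by metis+
  have s1: "(\<Sum>(a, b, c)\<in>cube N. of_bool (b < a \<and> a + c \<le> N) * w c a b)
      = (\<Sum>(a, b, c)\<in>cube N. of_bool (c < b \<and> b + a \<le> N) * w a b c)"
    using sum_cube_rotate[of "\<lambda>a b c. of_bool (b < a \<and> a + c \<le> N) * w c a b" N] by simp
  have s2: "(\<Sum>(a, b, c)\<in>cube N. of_bool (b < a \<and> a + c \<le> N) * w b c a)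
      = (\<Sum>(a, b, c)\<in>cube N. of_bool (a < c \<and> c + b \<le> N) * w a b c)"
    using sum_cube_rotate[of "\<lambda>a b c. of_bool (a < c \<and> c + b \<le> N) * w a b c" N] by simp
  have s3: "(\<Sum>(a, b, c)\<in>cube N. of_bool (c < b \<and> b < a) * w c a b)
      = (\<Sum>(a, b, c)\<in>cube N. of_bool (a < c \<and> c < b) * w a b c)"
    using sum_cube_rotate[of "\<lambda>a b c. of_bool (c < b \<and> b < a) * w c a b" N] by simp
  have s4: "(\<Sum>(a, b, c)\<in>cube N. of_bool (c < b \<and> b < a) * w b c a)
      = (\<Sum>(a, b, c)\<in>cube N. of_bool (b < a \<and> a < c) * w a b c)"
    using sum_cube_rotate[of "\<lambda>a b c. of_bool (b < a \<and> a < c) * w a b c" N] by simp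
  have "(\<Sum>(a, b, c)\<in>cube N. shuffle_weight N a b c * w a b c) =
      (\<Sum>(a, b, c)\<in>cube N. of_bool (a + b + c \<le> N) * w a b c)
    - (\<Sum>(a, b, c)\<in>cube N. of_bool (b < a \<and> a + c \<le> N) * w a b c)
    - (\<Sum>(a, b, c)\<in>cube N. of_bool (c < b \<and> b + a \<le> N) * w a b c)
    - (\<Sum>(a, b, c)\<in>cube N. of_bool (a < c \<and> c + b \<le> N) * w a b c)
    + (\<Sum>(a, b, c)\<in>cube N. of_bool (c < b \<and> b < a) * w a b c)
    + (\<Sum>(a, b, c)\<in>cube N. of_bool (a < c \<and> c < b) * w a b c)
    + (\<Sum>(a, b, c)\<in>cube N. of_bool (b < a \<and> a < c) * w a b c)"
    by (simp only: shuffle_weight_def case_prod_unfold left_diff_distrib distrib_right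
        sum.distrib sum_subtractf)
  then show ?thesis
    unfolding trunc_gen3_shuffle111[OF assms, symmetric] trunc_gen3_shuffle21[OF assms, symmetric]
    unfolding trunc_gen3_eq_cube sum_tetra_eq_cube yzx zxy s1[symmetric] s2[symmetric] s3[symmetric] s4[symmetric]
    by (simp add: w_def)
qed

section \<open>Coefficients of the triple zeta values\<close>

lemma sum_C3: "(\<Sum>(i, j, k)\<in>C3. f i j k) = f 1 2 3 + (f 2 3 1 + f 3 1 2)"
  by (simp add: C3_def)

lemma sum_S3:
  "(\<Sum>\<sigma>\<in>S3. f (\<sigma> 2) (\<sigma> 3)) = f 2 3 + f 3 2 + f 1 3 + f 3 1 + f 1 2 + f 2 1"
proof -
  have "finite {2::nat, 3}" "1 \<notin> {2::nat, 3}" "finite {3::nat}" "2 \<notin> {3::nat}"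
    by auto
  then show ?thesis
    unfolding S3_def
    by (simp add: sum_over_permutations_insert permutes_sing transpose_def add_ac)
qed

text \<open>The expression of \<open>c_coeff\<close> over any commutative ring, so that it can be
  used at real points, for polynomials and for rational functions.\<close>

definition gen_coeff :: "(nat \<Rightarrow> 'a::comm_ring_1) \<Rightarrow> nat \<Rightarrow> nat \<Rightarrow> nat \<Rightarrow> 'a" where
  "gen_coeff x l1 l2 l3 =
     (\<Sum>\<sigma>\<in>S3. (x 1 + x 2 + x 3) ^ (l1 - 1) * (x (\<sigma> 2) + x (\<sigma> 3)) ^ (l2 - 1) * x (\<sigma> 3) ^ (l3 - 1))
   + (\<Sum>(i, j, k)\<in>C3.
         x i ^ (l1 - 1) * x j ^ (l2 - 1) * x k ^ (l3 - 1)
       - (x i + x k) ^ (l1 - 1) * (x j + x k) ^ (l2 - 1) * x k ^ (l3 - 1)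
       - (x i + x k) ^ (l1 - 1) * (x k + x j) ^ (l2 - 1) * x j ^ (l3 - 1)
       - (x k + x i) ^ (l1 - 1) * x i ^ (l2 - 1) * x j ^ (l3 - 1))"

lemmas gen_coeff_expand = gen_coeff_def[unfolded sum_C3
  sum_S3[where f = "\<lambda>i j. (x 1 + x 2 + x 3) ^ (l1 - 1) * (x i + x j) ^ (l2 - 1) * x j ^ (l3 - 1)" for x l1 l2 l3]]

text \<open>With first exponent 0, the six terms over \<open>S3\<close> cancel the two families
  containing \<open>x j + x k\<close>, since \<open>{j, k}\<close> runs through all pairs. The other
  two families both run over the cyclic pairs and cancel each other.\<close>

lemma gen_coeff_1: "gen_coeff x (Suc 0) l2 l3 = 0"
  unfolding gen_coeff_expand by (simp add: algebra_simps)

lemma sum_gen_coeff_trunc_mzv3: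
  assumes "l \<ge> 3"
  shows "(\<Sum>(l1, l2, l3)\<in>triples l. gen_coeff x l1 l2 l3 * trunc_mzv3 N l1 l2 l3)
     = (\<Sum>(a, b, c)\<in>cube N. shuffle_weight N a b c * hom3 l (x 1) (x 2) (x 3) a b c)"
proof -
  have comm: "x 3 + x 2 = x 2 + x 3" "x 3 + x 1 = x 1 + x 3" "x 2 + x 1 = x 1 + x 2"
    by simp_all
  show ?thesis
    unfolding weighted_hom3_eq[OF assms] trunc_gen3_eq gen_coeff_expand comm
    by (simp only: case_prod_unfold distrib_right left_diff_distrib sum.distrib sum_subtractf)
qed

lemma sum_adm_triples:
  assumes "\<And>l2 l3. f (Suc 0) l2 l3 = 0"
  shows "(\<Sum>(l1, l2, l3)\<in>triples l. f l1 l2 l3) = (\<Sum>(l1, l2, l3)\<in>adm_triples l. f l1 l2 l3)"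
proof (rule sum.mono_neutral_right)
  show "\<forall>t\<in>triples l - adm_triples l. (case t of (l1, l2, l3) \<Rightarrow> f l1 l2 l3) = 0"
  proof clarify
    fix l1 l2 l3 assume "(l1, l2, l3) \<in> triples l" "(l1, l2, l3) \<notin> adm_triples l"
    then have "l1 = 1" by (auto simp: triples_def adm_triples_def)
    then show "f l1 l2 l3 = 0" using assms by simp
  qed
qed (auto simp: finite_triples, auto simp: triples_def adm_triples_def)

lemma sum_gen_coeff_mzv:
  fixes x :: "nat \<Rightarrow> real"
  assumes "l \<ge> 4"
  shows "(\<Sum>(l1, l2, l3)\<in>adm_triples l. gen_coeff x l1 l2 l3 * mzv [l1, l2, l3])
     = (\<Sum>(l1, l2, l3)\<in>triples l. x 1 ^ (l1 - 1) * x 2 ^ (l2 - 1) * x 3 ^ (l3 - 1)) * mzv [l]"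
proof -
  define H where "H = (\<Sum>(l1, l2, l3)\<in>triples l. x 1 ^ (l1 - 1) * x 2 ^ (l2 - 1) * x 3 ^ (l3 - 1))"
  define S where "S N = (\<Sum>(a, b, c)\<in>cube N. shuffle_weight N a b c * hom3 l (x 1) (x 2) (x 3) a b c)" for N
  have S: "S N = (\<Sum>(l1, l2, l3)\<in>adm_triples l. gen_coeff x l1 l2 l3 * trunc_mzv3 N l1 l2 l3)" for N
    unfolding S_def using assms
    by (subst sum_gen_coeff_trunc_mzv3[symmetric]) (auto intro!: sum_adm_triples simp: gen_coeff_1)
  have diag: "(\<Sum>m = 1..N. hom3 l (x 1) (x 2) (x 3) (real m) (real m) (real m))
      = H * (\<Sum>m = 1..N. 1 / real m ^ l)" for N
    unfolding H_def sum_product hom3_def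
    by (subst sum.swap, rule sum.cong, simp)
       (auto simp: triples_def power_add sum_distrib_left intro!: sum.cong)
  \<comment> \<open>Two limits of the same sequence \<open>S N\<close>: here term by term, next as
    the off-diagonal error plus the diagonal, which by \<open>diag\<close> is \<open>H\<close> times
    a partial sum of the zeta series.\<close>
  have "(\<lambda>N. \<Sum>(l1, l2, l3)\<in>adm_triples l. gen_coeff x l1 l2 l3 * trunc_mzv3 N l1 l2 l3)
      \<longlonglongrightarrow> (\<Sum>(l1, l2, l3)\<in>adm_triples l. gen_coeff x l1 l2 l3 * mzv [l1, l2, l3])"
    unfolding case_prod_unfold
    by (intro tendsto_sum tendsto_mult tendsto_const trunc_mzv3_tendsto) (auto simp: adm_triples_def)
  moreover have "(\<lambda>N. S N - (\<Sum>m = 1..N. hom3 l (x 1) (x 2) (x 3) (real m) (real m) (real m))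
      + H * (\<Sum>m = 1..N. 1 / real m ^ l)) \<longlonglongrightarrow> 0 + H * mzv [l]"
    unfolding S_def using assms
    by (intro tendsto_add weighted_hom3_tendsto tendsto_mult tendsto_const zeta_tendsto_mzv) auto
  ultimately show ?thesis
    unfolding diag S H_def[symmetric] by (auto dest: LIMSEQ_unique)
qed

subsection \<open>From real points to rational functions\<close>

definition XP :: "nat \<Rightarrow> real poly poly poly" where
  "XP i = (if i = 1 then [:[:[:0, 1:]:]:] else if i = 2 then [:[:0, 1:]:] else if i = 3 then [:0, 1:] else 0)"

text \<open>The third indeterminate is the outermost one in the nested polynomial ring, so it is
  evaluated first, at a constant of the inner ring.\<close>

definition eval3 :: "(nat \<Rightarrow> real) \<Rightarrow> real poly poly poly \<Rightarrow> real" where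
  "eval3 x p = poly (poly (poly p [:[:x 3:]:]) [:x 2:]) (x 1)"

lemma poly_eq_0_if_infinite_roots:
  fixes p :: "'a::idom poly" and c :: "real \<Rightarrow> 'a"
  assumes "\<And>r. poly p (c r) = 0" and "inj c"
  shows "p = 0"
proof (rule ccontr)
  assume "p \<noteq> 0"
  then have "finite {x. poly p x = 0}" by (rule poly_roots_finite)
  then have "finite (range c)" by (rule rev_finite_subset) (use assms in auto)
  then show False using assms(2) finite_imageD infinite_UNIV_char_0 by blast
qed

text \<open>One variable is removed at a time: a polynomial over an integral domain that vanishes at
  all embedded real constants has infinitely many roots.\<close>

lemma eq_0_if_eval3_eq_0:
  assumes "\<And>x. eval3 x p = 0"
  shows "p = 0"
proof (rule poly_eq_0_if_infinite_roots[where c = "\<lambda>r. [:[:r:]:]"])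
  fix r3
  show "poly p [:[:r3:]:] = 0"
  proof (rule poly_eq_0_if_infinite_roots[where c = "\<lambda>r. [:r:]"])
    fix r2
    show "poly (poly p [:[:r3:]:]) [:r2:] = 0"
    proof (rule poly_eq_0_if_infinite_roots[where c = "\<lambda>r. r"])
      show "poly (poly (poly p [:[:r3:]:]) [:r2:]) r1 = 0" for r1
        using assms[of "\<lambda>i. if i = 1 then r1 else if i = 2 then r2 else r3"]
        by (simp add: eval3_def)
    qed simp
  qed (simp add: inj_def)
qed (simp add: inj_def)

lemma to_fract_power: "to_fract (p ^ n) = to_fract p ^ n"
  by (induction n) simp_all

lemma to_fract_sum: "to_fract (sum f A) = (\<Sum>a\<in>A. to_fract (f a))"
  by (induction A rule: infinite_finite_induct) simp_all

lemma X_eq_to_fract: "X i = to_fract (XP i)"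
  by (simp add: X_def XP_def to_fract_def Zero_fract_def)

lemma rf_const_eq_to_fract: "rf_const r = to_fract [:[:[:r:]:]:]"
  by (simp add: rf_const_def to_fract_def)

lemma to_fract_gen_coeff: "to_fract (gen_coeff XP l1 l2 l3) = c_coeff l1 l2 l3"
  unfolding c_coeff_def gen_coeff_def X_eq_to_fract
  by (simp add: to_fract_power to_fract_sum case_prod_unfold)

lemma eval3_XP: "eval3 x (XP (Suc 0)) = x 1" "eval3 x (XP 1) = x 1" "eval3 x (XP 2) = x 2" "eval3 x (XP 3) = x 3"
  by (simp_all add: eval3_def XP_def)

lemma eval3_simps:
  "eval3 x (p + q) = eval3 x p + eval3 x q"
  "eval3 x (p - q) = eval3 x p - eval3 x q"
  "eval3 x (p * q) = eval3 x p * eval3 x q"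
  "eval3 x (p ^ n) = eval3 x p ^ n"
  "eval3 x (sum f A) = (\<Sum>a\<in>A. eval3 x (f a))"
  "eval3 x [:[:[:r:]:]:] = r"
  by (simp_all add: eval3_def poly_sum)

lemma eval3_gen_coeff: "eval3 x (gen_coeff XP l1 l2 l3) = gen_coeff x l1 l2 l3"
  unfolding gen_coeff_expand by (simp only: eval3_simps eval3_XP)

lemma sum_c_coeff_mzv:
  assumes "l \<ge> 4"
  shows "(\<Sum>(l1, l2, l3)\<in>adm_triples l. c_coeff l1 l2 l3 * rf_const (mzv [l1, l2, l3]))
       = (\<Sum>(l1, l2, l3)\<in>triples l. X 1 ^ (l1 - 1) * X 2 ^ (l2 - 1) * X 3 ^ (l3 - 1))
           * rf_const (mzv [l])"
proof -
  \<comment> \<open>Both sides come from the polynomial ring, where the identity can be tested at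
    real points.\<close>
  have "(\<Sum>(l1, l2, l3)\<in>adm_triples l. gen_coeff XP l1 l2 l3 * [:[:[:mzv [l1, l2, l3]:]:]:])
     - (\<Sum>(l1, l2, l3)\<in>triples l. XP 1 ^ (l1 - 1) * XP 2 ^ (l2 - 1) * XP 3 ^ (l3 - 1)) * [:[:[:mzv [l]:]:]:] = 0"
    (is "?p - ?q = 0")
  proof (rule eq_0_if_eval3_eq_0)
    show "eval3 x (?p - ?q) = 0" for x
      using sum_gen_coeff_mzv[OF assms, of x]
      by (simp only: eval3_simps eval3_XP eval3_gen_coeff case_prod_unfold)
  qed
  then have "to_fract ?p = to_fract ?q" by simp
  then show ?thesis
    by (simp only: to_fract_sum to_fract_mult to_fract_power to_fract_gen_coeff
        X_eq_to_fract rf_const_eq_to_fract case_prod_unfold)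
qed

section \<open>Passing between the two forms of the identity\<close>

text \<open>The sum is the complete homogeneous symmetric polynomial of degree \<open>l - 3\<close>,
  a coefficient of 1 / ((1 - a t)(1 - b t)(1 - c t)). Its partial fractions follow from 1 / (1 - y
  t) - 1 / (1 - z t) = (y - z) t / ((1 - y t)(1 - z t)).\<close>

lemma sum_triples_eq_partial_fractions:
  fixes a b c :: "'a::field"
  assumes "l \<ge> 3" "a \<noteq> b" "a \<noteq> c" "b \<noteq> c"
  shows "(\<Sum>(l1, l2, l3)\<in>triples l. a ^ (l1 - 1) * b ^ (l2 - 1) * c ^ (l3 - 1))
     = a ^ (l - 1) / ((a - b) * (a - c)) + b ^ (l - 1) / ((b - c) * (b - a)) + c ^ (l - 1) / ((c - a) * (c - b))"
proof -
  define P where "P y = Abs_fps (\<lambda>n. y ^ n)" for y :: 'a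
  have P: "P y * (1 - fps_const y * fps_X) = 1" for y
  proof (rule fps_ext)
    show "fps_nth (P y * (1 - fps_const y * fps_X)) n = fps_nth 1 n" for n
      by (cases n) (simp_all add: P_def right_diff_distrib mult.commute[of "fps_const y"] flip: mult.assoc)
  qed
  have diff: "fps_const (y - z) * fps_X * (P y * P z) = P y - P z" for y z
  proof -
    have "fps_const (y - z) * fps_X * (P y * P z)
        = P y * (P z * (1 - fps_const z * fps_X)) - P z * (P y * (1 - fps_const y * fps_X))"
      by (simp add: algebra_simps flip: fps_const_sub)
    then show ?thesis by (simp add: P)
  qed
  \<comment> \<open>Using \<open>diff\<close> twice absorbs two factors t, so coefficient
    \<open>l - 3\<close> of the product is read off at position \<open>l - 1\<close>.\<close>
  have "fps_const ((a - b) * (a - c) * (b - c)) * (P a * P b * P c) * fps_X ^ 2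
      = fps_const (a - c) * fps_const (b - c) * fps_X * P c * (fps_const (a - b) * fps_X * (P a * P b))"
    by (simp add: power2_eq_square mult_ac flip: fps_const_mult)
  also have "\<dots> = fps_const (b - c) * (fps_const (a - c) * fps_X * (P a * P c))
      - fps_const (a - c) * (fps_const (b - c) * fps_X * (P b * P c))"
    unfolding diff[of a b] by (simp only: right_diff_distrib mult_ac)
  also have "\<dots> = fps_const (b - c) * (P a - P c) - fps_const (a - c) * (P b - P c)"
    unfolding diff ..
  finally have "fps_nth (fps_const ((a - b) * (a - c) * (b - c)) * (P a * P b * P c) * fps_X ^ 2) (l - 1)
      = fps_nth (fps_const (b - c) * (P a - P c) - fps_const (a - c) * (P b - P c)) (l - 1)"
    by simp
  moreover have "l - 1 - 2 = l - 3" "\<not> l - 1 < 2" using assms by auto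
  ultimately have "(a - b) * (a - c) * (b - c) * fps_nth (P a * P b * P c) (l - 3)
      = (b - c) * (a ^ (l - 1) - c ^ (l - 1)) - (a - c) * (b ^ (l - 1) - c ^ (l - 1))"
    by (simp add: fps_X_power_mult_right_nth P_def)
  moreover have "fps_nth (P a * P b * P c) (l - 3)
      = (\<Sum>(l1, l2, l3)\<in>triples l. a ^ (l1 - 1) * b ^ (l2 - 1) * c ^ (l3 - 1))"
    unfolding P_def by (rule sum_triples_eq_fps_nth[OF assms(1), symmetric])
  moreover have "h = A / ((a - b) * (a - c)) + B / ((b - c) * (b - a)) + C / ((c - a) * (c - b))"
    if "(a - b) * (a - c) * (b - c) * h = (b - c) * (A - C) - (a - c) * (B - C)" for h A B C
  proof -
    have nz: "a - b \<noteq> 0" "a - c \<noteq> 0" "b - c \<noteq> 0" using assms by auto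
    have signs: "(b - c) * (b - a) = - ((b - c) * (a - b))" "(c - a) * (c - b) = (a - c) * (b - c)"
      by (simp_all add: algebra_simps)
    have "A / ((a - b) * (a - c)) + B / ((b - c) * (b - a)) + C / ((c - a) * (c - b))
        = A / ((a - b) * (a - c)) - B / ((b - c) * (a - b)) + C / ((a - c) * (b - c))"
      unfolding signs by simp
    also have "\<dots> = ((b - c) * A - (a - c) * B + (a - b) * C) / ((a - b) * (a - c) * (b - c))"
      using nz by (simp add: add_divide_distrib diff_divide_distrib)
    also have "(b - c) * A - (a - c) * B + (a - b) * C = (a - b) * (a - c) * (b - c) * h"
      unfolding that by (simp add: algebra_simps)
    finally show ?thesis using nz by simp
  qed
  ultimately show ?thesis by simp
qed

theorem theorem2:
  fixes l :: nat
  assumes "l \<ge> 4"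
  shows
    "(\<Sum>\<sigma>\<in>S3. T l (X 1 + X 2 + X 3) (X (\<sigma> 2) + X (\<sigma> 3)) (X (\<sigma> 3)))
       = (\<Sum>(i, j, k)\<in>C3.
            T l (X i + X k) (X j + X k) (X k)
          + T l (X i + X k) (X k + X j) (X j)
          + T l (X k + X i) (X i) (X j)
          - T l (X i) (X j) (X k)
          + X i ^ (l - 1) / ((X i - X j) * (X i - X k)) * rf_const (mzv [l]))
     \<and>
     (\<Sum>(l1, l2, l3)\<in>adm_triples l. c_coeff l1 l2 l3 * rf_const (mzv [l1, l2, l3]))
       = (\<Sum>(l1, l2, l3)\<in>triples l. X 1 ^ (l1 - 1) * X 2 ^ (l2 - 1) * X 3 ^ (l3 - 1))
           * rf_const (mzv [l])"
proof
  let ?z = "rf_const (mzv [l])"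
  have c: "c_coeff l1 l2 l3 = gen_coeff X l1 l2 l3" for l1 l2 l3
    by (simp add: c_coeff_def gen_coeff_def)
  \<comment> \<open>By linearity the left side of the second identity is a combination of values of
    \<open>T\<close>; moving terms across then gives the first identity up to the factor of
    \<open>?z\<close>.\<close>
  have "(\<Sum>(l1, l2, l3)\<in>adm_triples l. c_coeff l1 l2 l3 * rf_const (mzv [l1, l2, l3]))
     = (\<Sum>\<sigma>\<in>S3. T l (X 1 + X 2 + X 3) (X (\<sigma> 2) + X (\<sigma> 3)) (X (\<sigma> 3)))
     + (\<Sum>(i, j, k)\<in>C3. T l (X i) (X j) (X k) - T l (X i + X k) (X j + X k) (X k)
          - T l (X i + X k) (X k + X j) (X j) - T l (X k + X i) (X i) (X j))"
    unfolding c gen_coeff_expand sum_C3 T_def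
      sum_S3[where f = "\<lambda>i j. T l (X 1 + X 2 + X 3) (X i + X j) (X j)", unfolded T_def]
    by (simp only: case_prod_unfold distrib_right left_diff_distrib sum.distrib sum_subtractf)
  then have "(\<Sum>\<sigma>\<in>S3. T l (X 1 + X 2 + X 3) (X (\<sigma> 2) + X (\<sigma> 3)) (X (\<sigma> 3)))
     = (\<Sum>(i, j, k)\<in>C3. T l (X i + X k) (X j + X k) (X k) + T l (X i + X k) (X k + X j) (X j)
          + T l (X k + X i) (X i) (X j) - T l (X i) (X j) (X k))
     + (\<Sum>(l1, l2, l3)\<in>triples l. X 1 ^ (l1 - 1) * X 2 ^ (l2 - 1) * X 3 ^ (l3 - 1)) * ?z"
    unfolding sum_c_coeff_mzv[OF assms] sum_C3 by (simp add: algebra_simps)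
  also have "(\<Sum>(l1, l2, l3)\<in>triples l. X 1 ^ (l1 - 1) * X 2 ^ (l2 - 1) * X 3 ^ (l3 - 1))
     = (\<Sum>(i, j, k)\<in>C3. X i ^ (l - 1) / ((X i - X j) * (X i - X k)))"
    unfolding sum_C3 using assms X_distinct
    by (subst sum_triples_eq_partial_fractions) (auto simp: add.assoc)
  finally show "(\<Sum>\<sigma>\<in>S3. T l (X 1 + X 2 + X 3) (X (\<sigma> 2) + X (\<sigma> 3)) (X (\<sigma> 3)))
       = (\<Sum>(i, j, k)\<in>C3.
            T l (X i + X k) (X j + X k) (X k)
          + T l (X i + X k) (X k + X j) (X j)
          + T l (X k + X i) (X i) (X j)
          - T l (X i) (X j) (X k)
          + X i ^ (l - 1) / ((X i - X j) * (X i - X k)) * ?z)"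
    by (simp only: sum_distrib_right case_prod_unfold sum.distrib)
qed (rule sum_c_coeff_mzv[OF assms])

end
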